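(* Let $X$ be a finite ground set, let $d\ge 0$ be an integer, and let $f:2^X\to\mathbb{R}$ be a normalized monotone set function. Then $f$ is $d$-scopic subadditive if and only if $\mathrm{SAW}(f)\le d$.
   Context: A set function $f:2^X\to\mathbb{R}$ is normalized if $f(\emptyset)=0$ and monotone if $f(S)\le f(T)$ whenever $S\subseteq T\subseteq X$. For $S,T\subseteq X$ write $f(S\mid T)=f(S\cup T)-f(T)$. A set $T\subseteq X$ is superadditive w.r.t. $f$ if there exists $S\subseteq X\setminus T$ such that $f(S\mid T)>\max_{T'\subsetneq T} f(S\mid T')$. The superadditive width $\mathrm{SAW}(f)$ is the maximum cardinality of a nonempty superadditive set w.r.t. $f$ (and $0$ if there is none). For an integer $d\ge 0$, $f$ is $d$-scopic subadditive if for all $S,T\subseteq X$ with $S\cap T=\emptyset$: $f(S\mid T)\le \max_{T'\subseteq T,\ |T'|\le d} f(S\mid T')$. *)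

theory Defs
  imports Complex_Main
begin

text \<open>
  A set function on the subsets of a ground set X is a function on all of \<^typ>\<open>'a set\<close>;
  every definition below evaluates it on subsets of X only.
\<close>

definition normalized :: "('a set \<Rightarrow> real) \<Rightarrow> bool" where
  "normalized f \<longleftrightarrow> f {} = 0"

definition monotone_setfun :: "'a set \<Rightarrow> ('a set \<Rightarrow> real) \<Rightarrow> bool" where
  "monotone_setfun X f \<longleftrightarrow> (\<forall>S T. S \<subseteq> T \<and> T \<subseteq> X \<longrightarrow> f S \<le> f T)"

definition marginal :: "('a set \<Rightarrow> real) \<Rightarrow> 'a set \<Rightarrow> 'a set \<Rightarrow> real" where
  "marginal f S T = f (S \<union> T) - f T"

text \<open>
  For a finite nonempty T the maximum is over a finite nonempty set. For T empty it would be a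
  maximum over the empty set, which \<^const>\<open>Max\<close> leaves unspecified; the superadditive width
  considers nonempty T only.
\<close>

definition superadditive_set :: "'a set \<Rightarrow> ('a set \<Rightarrow> real) \<Rightarrow> 'a set \<Rightarrow> bool" where
  "superadditive_set X f T \<longleftrightarrow>
     T \<subseteq> X \<and> (\<exists>S. S \<subseteq> X - T \<and> marginal f S T > Max {marginal f S T' | T'. T' \<subset> T})"

definition SAW :: "'a set \<Rightarrow> ('a set \<Rightarrow> real) \<Rightarrow> nat" where
  "SAW X f =
     (if \<exists>T. T \<noteq> {} \<and> superadditive_set X f T
      then Max {card T | T. T \<noteq> {} \<and> superadditive_set X f T}
      else 0)"

definition scopic_subadditive :: "nat \<Rightarrow> 'a set \<Rightarrow> ('a set \<Rightarrow> real) \<Rightarrow> bool" where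
  "scopic_subadditive d X f \<longleftrightarrow>
     (\<forall>S T. S \<subseteq> X \<and> T \<subseteq> X \<and> S \<inter> T = {} \<longrightarrow>
        marginal f S T \<le> Max {marginal f S T' | T'. T' \<subseteq> T \<and> card T' \<le> d})"

end

theory Submission
  imports Defs
begin

text \<open>A nonempty \<open>T\<close> fails to be superadditive exactly when every
  \<open>S\<close> disjoint from it has a proper subset \<open>T'\<close> of \<open>T\<close> at
  which its marginal is at least as large. So if no superadditive set has more than \<open>d\<close>
  elements, any larger \<open>T\<close> can be shrunk without decreasing the marginal of a fixed
  \<open>S\<close>, and by finiteness this stops at a set of size at most \<open>d\<close>.
  Conversely, a superadditive \<open>T\<close> with more than \<open>d\<close> elements comes with
  an \<open>S\<close> whose marginal is strictly smaller at all proper subsets, hence at all subsets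
  of size at most \<open>d\<close>, which violates scopic subadditivity. The three
  \<open>iff\<close> lemmas replace each \<open>Max\<close> by quantifiers, so that this argument
  applies directly.\<close>

lemma superadditive_set_iff:
  assumes "finite T" and "T \<noteq> {}"
  shows "superadditive_set X f T \<longleftrightarrow>
    T \<subseteq> X \<and> (\<exists>S \<subseteq> X - T. \<forall>T'. T' \<subset> T \<longrightarrow> marginal f S T' < marginal f S T)"
proof -
  have "Max {marginal f S T' | T'. T' \<subset> T} < marginal f S T \<longleftrightarrow>
      (\<forall>T'. T' \<subset> T \<longrightarrow> marginal f S T' < marginal f S T)" for S
  proof -
    have "finite {T'. T' \<subset> T}"
      by (rule finite_subset[of _ "Pow T"]) (use assms in auto)
    then have "finite {marginal f S T' | T'. T' \<subset> T}"
      by simp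
    \<comment> \<open>The empty set is a proper subset of \<open>T\<close>; this is where
      \<open>T \<noteq> {}\<close> enters.\<close>
    moreover have "{marginal f S T' | T'. T' \<subset> T} \<noteq> {}"
      using assms by auto
    ultimately show ?thesis
      by (subst Max_less_iff) auto
  qed
  then show ?thesis
    unfolding superadditive_set_def by auto
qed

lemma scopic_subadditive_iff:
  assumes "finite X"
  shows "scopic_subadditive d X f \<longleftrightarrow>
    (\<forall>S T. S \<subseteq> X \<and> T \<subseteq> X \<and> S \<inter> T = {} \<longrightarrow>
      (\<exists>T' \<subseteq> T. card T' \<le> d \<and> marginal f S T \<le> marginal f S T'))"
proof -
  have "marginal f S T \<le> Max {marginal f S T' | T'. T' \<subseteq> T \<and> card T' \<le> d} \<longleftrightarrow>
      (\<exists>T' \<subseteq> T. card T' \<le> d \<and> marginal f S T \<le> marginal f S T')" if "T \<subseteq> X" for S T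
  proof -
    have "finite {T'. T' \<subseteq> T \<and> card T' \<le> d}"
      by (rule finite_subset[of _ "Pow X"]) (use assms that in auto)
    then have "finite {marginal f S T' | T'. T' \<subseteq> T \<and> card T' \<le> d}"
      by simp
    \<comment> \<open>The empty set is a candidate for every \<open>d\<close>, even
      \<open>d = 0\<close>, so the maximum is over a nonempty set.\<close>
    moreover have "marginal f S {} \<in> {marginal f S T' | T'. T' \<subseteq> T \<and> card T' \<le> d}"
      by force
    ultimately show ?thesis
      by (subst Max_ge_iff) auto
  qed
  then show ?thesis
    unfolding scopic_subadditive_def by (intro iff_allI imp_cong refl) simp
qed

text \<open>If there is no nonempty superadditive set, the default value 0 matches the vacuous
  right-hand side. Otherwise the maximum is genuine, since superadditive sets are subsets of the
  finite \<open>X\<close>.\<close>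

lemma SAW_le_iff:
  assumes "finite X"
  shows "SAW X f \<le> d \<longleftrightarrow> (\<forall>T. T \<noteq> {} \<and> superadditive_set X f T \<longrightarrow> card T \<le> d)"
proof -
  have "finite {T. T \<noteq> {} \<and> superadditive_set X f T}"
    by (rule finite_subset[of _ "Pow X"]) (use assms in \<open>auto simp: superadditive_set_def\<close>)
  then have "finite {card T | T. T \<noteq> {} \<and> superadditive_set X f T}"
    by simp
  then show ?thesis
    unfolding SAW_def by (auto simp: Max_le_iff)
qed

theorem theorem2:
  fixes X :: "'a set" and f :: "'a set \<Rightarrow> real" and d :: nat
  assumes "finite X"
    and "normalized f"
    and "monotone_setfun X f"
  shows "scopic_subadditive d X f \<longleftrightarrow> SAW X f \<le> d"
proof
  assume "scopic_subadditive d X f"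
  then have scopic: "\<exists>T' \<subseteq> T. card T' \<le> d \<and> marginal f S T \<le> marginal f S T'"
    if "S \<subseteq> X" "T \<subseteq> X" "S \<inter> T = {}" for S T
    using that by (simp add: scopic_subadditive_iff[OF assms(1)])
  have "card T \<le> d" if "T \<noteq> {}" and sup: "superadditive_set X f T" for T
  proof (rule ccontr)
    assume "\<not> card T \<le> d"
    have "T \<subseteq> X"
      using sup by (simp add: superadditive_set_def)
    then have "finite T"
      using assms(1) finite_subset by blast
    then obtain S where S: "S \<subseteq> X - T"
      and less: "\<And>T'. T' \<subset> T \<Longrightarrow> marginal f S T' < marginal f S T"
      using sup unfolding superadditive_set_iff[OF \<open>finite T\<close> \<open>T \<noteq> {}\<close>] by blast
    have "S \<subseteq> X" "S \<inter> T = {}"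
      using S by auto
    then obtain T' where "T' \<subseteq> T" "card T' \<le> d" "marginal f S T \<le> marginal f S T'"
      using scopic[of S T] \<open>T \<subseteq> X\<close> by auto
    \<comment> \<open>\<open>T' = T\<close> is excluded by cardinality.\<close>
    moreover from this \<open>\<not> card T \<le> d\<close> have "T' \<subset> T"
      by auto
    ultimately show False
      using less[of T'] by simp
  qed
  then show "SAW X f \<le> d"
    by (simp add: SAW_le_iff[OF assms(1)])
next
  assume "SAW X f \<le> d"
  then have width: "card T \<le> d" if "T \<noteq> {}" "superadditive_set X f T" for T
    using that by (simp add: SAW_le_iff[OF assms(1)])
  have "\<exists>T' \<subseteq> T. card T' \<le> d \<and> marginal f S T \<le> marginal f S T'"
    if "S \<subseteq> X" "T \<subseteq> X" "S \<inter> T = {}" for S T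
  proof -
    have "finite T"
      using \<open>T \<subseteq> X\<close> assms(1) finite_subset by blast
    then show ?thesis
      using that
    \<comment> \<open>\<open>S\<close> stays fixed while \<open>T\<close> shrinks; disjointness from
      \<open>S\<close> passes to subsets.\<close>
    proof (induction T rule: finite_psubset_induct)
      case (psubset T)
      show ?case
      proof (cases "card T \<le> d")
        case False
        then have "T \<noteq> {}"
          by auto
        moreover from this have "\<not> superadditive_set X f T"
          using width False by blast
        moreover have "S \<subseteq> X - T"
          using psubset.prems by auto
        \<comment> \<open>Failure of superadditivity is instantiated at this particular
          \<open>S\<close>.\<close>
        ultimately obtain T' where T': "T' \<subset> T" "marginal f S T \<le> marginal f S T'"
          using psubset.prems(2) superadditive_set_iff[OF psubset.hyps, of X f] not_less by metis
        \<comment> \<open>\<open>T'\<close> may still have more than \<open>d\<close> elements; the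
          induction hypothesis finishes the shrinking, and the two inequalities chain.\<close>
        then obtain T'' where "T'' \<subseteq> T'" "card T'' \<le> d" "marginal f S T' \<le> marginal f S T''"
          using psubset.IH[of T'] psubset.prems by blast
        with T' show ?thesis
          by (intro exI[of _ T'']) auto
      \<comment> \<open>In the remaining case \<open>card T \<le> d\<close>, the set
        \<open>T\<close> is its own witness.\<close>
      qed auto
    qed
  qed
  then show "scopic_subadditive d X f"
    by (simp add: scopic_subadditive_iff[OF assms(1)])
qed

end
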